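(* Let $m,n\ge 1$, $A\in\mathbb{R}^{m\times n^2}$, $f\in\mathbb{R}^m$, $\mu>0$, and suppose $\mathcal{N}(A)\cap\mathcal{N}(D)=\{0\}$, where $\mathcal N(\cdot)$ denotes the null space. Let $\beta>0$ and $0<\tau<2/\lambda_{\max}(A^\top A)$, where $\lambda_{\max}(A^\top A)$ denotes the spectral radius of $A^\top A$. Let $\{(w^k,u^k)\}$ be generated by the FTVCS iteration from any starting point $(w^0,u^0)\in\mathbb{R}^{2n^2}\times\mathbb{R}^{n^2}$, and let $u^*$ be the limit of $\{u^k\}$ (where $(w^*,u^* )$, the limit of $\{(w^k,u^k)\}$, is a solution of $\min_{u,w}\sum_{i=1}^{n^2}(\|\mathbf{w}_i\|+\frac{\beta}{2}\|\mathbf{w}_i-D_iu\|^2)+\frac{\mu}{2}\|Au-f\|^2$). Then $\{u^k\}$ converges to $u^*$ $q$-linearly.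
   Context: All norms $\|\cdot\|$ are Euclidean unless otherwise said. An $n\times n$ image is identified with a vector $u\in\mathbb{R}^{n^2}$. $D^{(1)},D^{(2)}\in\mathbb{R}^{n^2\times n^2}$ are the first-order finite difference matrices in the horizontal and vertical directions, with periodic boundary conditions; $D=\begin{pmatrix}D^{(1)}\\ D^{(2)}\end{pmatrix}\in\mathbb{R}^{2n^2\times n^2}$; and $D_i\in\mathbb{R}^{2\times n^2}$ is formed by stacking the $i$th row of $D^{(1)}$ on that of $D^{(2)}$. A vector $w\in\mathbb{R}^{2n^2}$ is a reordering of vectors $\mathbf{w}_i\in\mathbb{R}^2$, $i=1,\dots,n^2$, where $\mathbf{w}_i$ has entries $w_i$ and $w_{i+n^2}$ (so $w=Du$ iff $\mathbf{w}_i=D_iu$ for all $i$). FTVCS iteration (parameters $\mu,\beta,\tau>0$): given $u^k$, (1) for $i=1,\dots,n^2$ set $\mathbf{w}_i^{k+1}=\max\{\|D_iu^k\|-1/\beta,\,0\}\,\dfrac{D_iu^k}{\|D_iu^k\|}$, with the convention $0\cdot(0/0)=0$; (2) let $u^{k+1}$ be the solution of $\big(D^\top D+\frac{\mu}{\beta\tau}I\big)u^{k+1}=D^\top w^{k+1}+\frac{\mu}{\beta\tau}(u^k-\tau g_k)$, where $g_k=A^\top(Au^k-f)$. $q$-linear convergence of $u^k\to u^*$ means: for some norm $\|\cdot\|_*$ on $\mathbb{R}^{n^2}$ there are $c\in(0,1)$ and $K$ with $\|u^{k+1}-u^*\|_*\le c\,\|u^k-u^*\|_*$ for all $k\ge K$.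 *)

theory Defs
  imports "HOL-Analysis.Analysis"
begin

text \<open>
  An $n \times n$ image is a vector indexed by pixels (row, column) in \<open>'n \<times> 'n\<close>, where
  \<open>n = CARD('n)\<close>; the linear order on \<open>'n\<close> enumerates the rows and the columns.
  Vectors in $R^{2n^2}$ are indexed by the sum of two copies of the pixel type: \<open>Inl i\<close>
  stands for the index $i$ and \<open>Inr i\<close> for the index $i + n^2$.
\<close>

type_synonym 'n pixel = "'n \<times> 'n"

definition next_index :: "'n::{finite,linorder} \<Rightarrow> 'n" where
  "next_index i = (if \<exists>j. i < j then Min {j. i < j} else Min UNIV)"

definition diff_horiz :: "real ^ ('n::{finite,linorder}) pixel ^ 'n pixel" where
  "diff_horiz = (\<chi> p q. of_bool (q = (fst p, next_index (snd p))) - of_bool (q = p))"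

definition diff_vert :: "real ^ ('n::{finite,linorder}) pixel ^ 'n pixel" where
  "diff_vert = (\<chi> p q. of_bool (q = (next_index (fst p), snd p)) - of_bool (q = p))"

definition diff_op :: "real ^ ('n::{finite,linorder}) pixel ^ ('n pixel + 'n pixel)" where
  "diff_op = (\<chi> r. case r of Inl i \<Rightarrow> row i diff_horiz | Inr i \<Rightarrow> row i diff_vert)"

definition diff_at :: "('n::{finite,linorder}) pixel \<Rightarrow> real ^ 'n pixel ^ 2" where
  "diff_at i = vector [row i diff_horiz, row i diff_vert]"

definition block :: "real ^ ('p + 'p) \<Rightarrow> 'p::finite \<Rightarrow> real ^ 2" where
  "block w i = vector [w $ Inl i, w $ Inr i]"

definition null_space :: "real ^ 'n ^ 'm \<Rightarrow> (real ^ 'n) set" where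
  "null_space M = {x. M *v x = 0}"

definition eigenvalues :: "complex ^ 'n ^ 'n \<Rightarrow> complex set" where
  "eigenvalues M = {z. \<exists>v. v \<noteq> 0 \<and> M *v v = z *s v}"

definition spectral_radius :: "real ^ 'n ^ 'n \<Rightarrow> real" where
  "spectral_radius M = Sup (cmod ` eigenvalues (map_matrix complex_of_real M))"

text \<open>At \<open>x = 0\<close> the quotient is \<open>0\<close> because \<open>inverse 0 = 0\<close>, so \<open>shrink b 0 = 0\<close>,
  in accordance with the convention $0 \cdot (0/0) = 0$.\<close>

definition shrink :: "real \<Rightarrow> 'a::real_normed_vector \<Rightarrow> 'a" where
  "shrink b x = max (norm x - 1 / b) 0 *\<^sub>R (x /\<^sub>R norm x)"

definition fidelity_grad :: "real ^ 'p ^ 'm \<Rightarrow> real ^ 'm \<Rightarrow> real ^ 'p \<Rightarrow> real ^ 'p" where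
  "fidelity_grad A f u = transpose A *v (A *v u - f)"

definition ftvcs ::
  "real ^ ('n::{finite,linorder}) pixel ^ 'm \<Rightarrow> real ^ 'm \<Rightarrow> real \<Rightarrow> real \<Rightarrow> real
    \<Rightarrow> (nat \<Rightarrow> real ^ ('n pixel + 'n pixel)) \<Rightarrow> (nat \<Rightarrow> real ^ 'n pixel) \<Rightarrow> bool" where
  "ftvcs A f \<mu> \<beta> \<tau> w u \<longleftrightarrow>
    (\<forall>k. (\<forall>i. block (w (Suc k)) i = shrink \<beta> (diff_at i *v u k)) \<and>
         (transpose diff_op ** diff_op + (\<mu> / (\<beta> * \<tau>)) *\<^sub>R mat 1) *v u (Suc k) =
           transpose diff_op *v w (Suc k)
             + (\<mu> / (\<beta> * \<tau>)) *\<^sub>R (u k - \<tau> *\<^sub>R fidelity_grad A f (u k)))"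

definition penalized_objective ::
  "real ^ ('n::{finite,linorder}) pixel ^ 'm \<Rightarrow> real ^ 'm \<Rightarrow> real \<Rightarrow> real
    \<Rightarrow> real ^ ('n pixel + 'n pixel) \<Rightarrow> real ^ 'n pixel \<Rightarrow> real" where
  "penalized_objective A f \<mu> \<beta> w u =
    (\<Sum>i\<in>UNIV. norm (block w i) + \<beta> / 2 * (norm (block w i - diff_at i *v u))\<^sup>2)
      + \<mu> / 2 * (norm (A *v u - f))\<^sup>2"

definition is_norm :: "('a::real_vector \<Rightarrow> real) \<Rightarrow> bool" where
  "is_norm N \<longleftrightarrow>
    (\<forall>x. 0 \<le> N x) \<and> (\<forall>x. N x = 0 \<longleftrightarrow> x = 0) \<and>
    (\<forall>a x. N (a *\<^sub>R x) = \<bar>a\<bar> * N x) \<and> (\<forall>x y. N (x + y) \<le> N x + N y)"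

definition q_linearly_convergent :: "(nat \<Rightarrow> 'a::real_vector) \<Rightarrow> 'a \<Rightarrow> bool" where
  "q_linearly_convergent x l \<longleftrightarrow>
    (\<exists>N c K. is_norm N \<and> 0 < c \<and> c < 1 \<and> (\<forall>k\<ge>K. N (x (Suc k) - l) \<le> c * N (x k - l)))"

end

theory Submission
  imports Defs
begin

text \<open>
  Write \<open>P\<close> for the map that projects every block $\mathbf{w}_i$ onto the ball of radius $1/\beta$.
  Shrinkage is \<open>id - P\<close>, that is, the proximal map of $\beta^{-1} \sum_i \|\mathbf{w}_i\|$, so one
  step of the iteration solves
  $(D^T D + cI) u' = D^T (Du - P(Du)) + c (u - \tau A^T(Au - f))$ with $c = \mu/(\beta\tau)$.
  Let $N(x)^2 = \|Dx\|^2 + c \|x\|^2$. Since \<open>id - P\<close> is firmly nonexpansive and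
  $\tau \lambda_{\max}(A^T A) < 2$, any two steps $u \mapsto u'$ and $v \mapsto v'$ satisfy, for some
  $\kappa > 0$,
  $$N(u' - v')^2 + \|P(Du) - P(Dv)\|^2 + \kappa \|A(u - v)\|^2 \le N(u - v)^2$$
  (lemma \<open>step_energy\<close>). Two facts turn this inequality into the theorem.

  First, \<open>p\<close> is a fixed point iff $\beta D^T P(Dp) + \mu A^T(Ap - f) = 0$, and this condition depends
  on \<open>p\<close> only through \<open>P(Dp)\<close> and \<open>Ap\<close>, the two quantities that the inequality controls. The left
  side is the gradient of the objective after minimization over \<open>w\<close>, so fixed points are the
  minimizers; they exist because $\mathcal N(A) \cap \mathcal N(D) = \{0\}$ makes the objective
  coercive. Distances in \<open>N\<close> to a fixed point decrease, hence the iterates are bounded, and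
  comparing with any fixed point shows that every cluster point is again a fixed point. The whole
  sequence therefore converges to one of them.

  Second, \<open>N\<close> itself is the norm of the linear rate. The step is in general not a local contraction
  around the limit $u^*$, as minimizers need not be unique: \<open>P\<close> is constant on rays that leave the ball.
  Suppose that no rate below 1 holds eventually. Then along a subsequence the inequality, divided
  by $\|u^k - u^*\|^2$, forces the normalized errors to have a limit \<open>p\<close> with $Ap = 0$ along which
  \<open>P\<close> is flat to first order at $Du^*$. For the projection onto a ball, flatness to first order
  implies that \<open>P\<close> is constant on a short segment (lemma
  \<open>clip_locally_constant_on_flat_ray\<close>), so $u^* + sp$ is a fixed point for all small $s > 0$. But
  distances to this fixed point also decrease, and they tend to $N(sp)$; hence
  $N(u^k - u^* - sp) \ge N(sp)$ for every \<open>k\<close>. With $s = \|u^k - u^*\|$ this keeps the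
  normalized errors at distance at least $N(p)$ from \<open>p\<close>, a contradiction.
\<close>

section \<open>Spectral radius and the norm of a matrix\<close>

text \<open>Keeps \<open>transpose M *v x\<close> from being rewritten to \<open>x v* M\<close>, so that adjoints stay visible.\<close>

declare transpose_matrix_vector [simp del]

lemma nonneg_quadratic_imp_linear_coeff_zero:
  fixes a b :: real
  assumes "\<And>t. 0 \<le> a * t\<^sup>2 + b * t"
  shows "b = 0"
proof (rule ccontr)
  assume b: "b \<noteq> 0"
  define e where "e = \<bar>a\<bar> + 1"
  have e: "e > 0" "a \<le> e" by (auto simp: e_def)
  have "0 \<le> a * (- b / (2 * e))\<^sup>2 + b * (- b / (2 * e))" by (rule assms)
  also have "\<dots> \<le> e * (- b / (2 * e))\<^sup>2 + b * (- b / (2 * e))"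
    using e by (intro add_right_mono mult_right_mono) auto
  also have "\<dots> = - (b\<^sup>2 / (4 * e))"
    using e by (simp add: field_simps power2_eq_square)
  also have "\<dots> < 0" using e b by simp
  finally show False by simp
qed

lemma norm_add_scaleR_sq:
  fixes x h :: "'a::real_inner"
  shows "(norm (x + t *\<^sub>R h))\<^sup>2 = (norm x)\<^sup>2 + 2 * t * (x \<bullet> h) + t\<^sup>2 * (norm h)\<^sup>2"
  unfolding power2_norm_eq_inner
  by (simp add: inner_add_left inner_add_right inner_commute power2_eq_square algebra_simps)

lemma inner_transpose_matrix:
  fixes M :: "real ^ 'p ^ 'q"
  shows "(transpose M *v x) \<bullet> y = x \<bullet> (M *v y)"
  by (simp add: dot_lmul_matrix transpose_matrix_vector)

lemma inner_transpose_matrix_right: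
  fixes M :: "real ^ 'p ^ 'q"
  shows "y \<bullet> (transpose M *v x) = (M *v y) \<bullet> x"
  by (metis inner_commute inner_transpose_matrix)

lemma norm_vector_scalar_mult:
  fixes v :: "complex ^ 'n"
  shows "norm (z *s v) = cmod z * norm v"
  by (simp add: norm_vec_def L2_set_right_distrib norm_mult)

text \<open>The supremum of an unbounded set of reals is an arbitrary value; this rules it out for \<open>spectral_radius\<close>.\<close>

lemma bdd_above_cmod_eigenvalues:
  fixes M :: "complex ^ 'n ^ 'n"
  shows "bdd_above (cmod ` eigenvalues M)"
proof -
  have "linear (\<lambda>v. M *v v)"
    by (intro linearI)
      (simp_all add: matrix_vector_mult_def vec_eq_iff scaleR_sum_right
        distrib_left sum.distrib)
  then obtain K where K: "\<And>v. norm (M *v v) \<le> K * norm v"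
    using linear_bounded by blast
  have "cmod z \<le> K" if "z \<in> eigenvalues M" for z
  proof -
    from that obtain v where "v \<noteq> 0" "M *v v = z *s v"
      by (auto simp: eigenvalues_def)
    then show ?thesis using K[of v] by (simp add: norm_vector_scalar_mult)
  qed
  then show ?thesis by (auto intro!: bdd_aboveI)
qed

lemma real_eigenvalue_le_spectral_radius:
  fixes M :: "real ^ 'n ^ 'n"
  assumes "x \<noteq> 0" "M *v x = l *\<^sub>R x"
  shows "l \<le> spectral_radius M"
proof -
  define v where "v = (\<chi> i. complex_of_real (x $ i))"
  have "v \<noteq> 0" using assms(1) by (auto simp: v_def vec_eq_iff)
  moreover have "map_matrix complex_of_real M *v v = complex_of_real l *s v"
  proof -
    have "(\<Sum>j\<in>UNIV. M $ i $ j * x $ j) = l * x $ i" for i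
      using assms(2) by (simp add: vec_eq_iff matrix_vector_mult_def)
    then have "(\<Sum>j\<in>UNIV. complex_of_real (M $ i $ j) * complex_of_real (x $ j))
        = complex_of_real l * complex_of_real (x $ i)" for i
      by (metis (no_types, lifting) of_real_mult of_real_sum sum.cong)
    then show ?thesis
      by (simp add: vec_eq_iff matrix_vector_mult_def map_matrix_def v_def)
  qed
  ultimately have "complex_of_real l \<in> eigenvalues (map_matrix complex_of_real M)"
    by (auto simp: eigenvalues_def)
  then have "cmod (complex_of_real l) \<le> spectral_radius M"
    unfolding spectral_radius_def
    by (intro cSup_upper bdd_above_cmod_eigenvalues imageI)
  then show ?thesis by simp
qed

text \<open>The maximum of \<open>(norm (A *v x))\<^sup>2\<close> over the unit sphere is an eigenvalue of \<open>transpose A ** A\<close>: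
  with \<open>l\<close> the maximum and \<open>x0\<close> a maximizer, the form \<open>l * (norm y)\<^sup>2 - (norm (A *v y))\<^sup>2\<close> is
  nonnegative and vanishes at \<open>x0\<close>, so its gradient vanishes there.\<close>

lemma norm_mult_sq_le_spectral_radius:
  fixes A :: "real ^ 'p ^ 'm"
  shows "(norm (A *v x))\<^sup>2 \<le> spectral_radius (transpose A ** A) * (norm x)\<^sup>2"
proof -
  have ne: "sphere (0 :: real ^ 'p) 1 \<noteq> {}" by simp
  have "continuous_on (sphere 0 1) (\<lambda>x. (norm (A *v x))\<^sup>2)"
    by (intro continuous_intros linear_continuous_on_compose[OF _ matrix_vector_mul_linear])
  then obtain x0 where x0: "norm x0 = 1" "\<And>y. norm y = 1 \<Longrightarrow> (norm (A *v y))\<^sup>2 \<le> (norm (A *v x0))\<^sup>2"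
    using continuous_attains_sup[OF compact_sphere ne, of "\<lambda>x. (norm (A *v x))\<^sup>2"] by auto
  define l where "l = (norm (A *v x0))\<^sup>2"
  have le: "(norm (A *v y))\<^sup>2 \<le> l * (norm y)\<^sup>2" for y
  proof (cases "y = 0")
    case False
    then have "(norm (A *v (y /\<^sub>R norm y)))\<^sup>2 \<le> l"
      unfolding l_def by (intro x0(2)) simp
    then show ?thesis using False
      by (simp add: matrix_vector_mult_scaleR power_mult_distrib field_simps)
  qed simp
  have "(transpose A ** A) *v x0 = l *\<^sub>R x0"
  proof -
    have "(l *\<^sub>R x0 - transpose A *v (A *v x0)) \<bullet> h = 0" for h
    proof -
      have "0 \<le> (l * (norm h)\<^sup>2 - (norm (A *v h))\<^sup>2) * t\<^sup>2
          + 2 * ((l *\<^sub>R x0 - transpose A *v (A *v x0)) \<bullet> h) * t" for t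
      proof -
        have "0 \<le> l * (norm (x0 + t *\<^sub>R h))\<^sup>2 - (norm (A *v (x0 + t *\<^sub>R h)))\<^sup>2"
          using le by simp
        also have "\<dots> = l * ((norm x0)\<^sup>2 + 2 * t * (x0 \<bullet> h) + t\<^sup>2 * (norm h)\<^sup>2)
            - ((norm (A *v x0))\<^sup>2 + 2 * t * ((A *v x0) \<bullet> (A *v h)) + t\<^sup>2 * (norm (A *v h))\<^sup>2)"
          by (simp add: norm_add_scaleR_sq matrix_vector_right_distrib matrix_vector_mult_scaleR)
        also have "\<dots> = (l * (norm h)\<^sup>2 - (norm (A *v h))\<^sup>2) * t\<^sup>2
          + 2 * ((l *\<^sub>R x0 - transpose A *v (A *v x0)) \<bullet> h) * t"
          using x0(1) by (simp add: l_def inner_diff_left inner_transpose_matrix algebra_simps)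
        finally show ?thesis .
      qed
      from nonneg_quadratic_imp_linear_coeff_zero[OF this] show ?thesis by simp
    qed
    then have "l *\<^sub>R x0 - transpose A *v (A *v x0) = 0"
      using inner_eq_zero_iff by blast
    then show ?thesis by (simp add: matrix_vector_mul_assoc)
  qed
  moreover have "x0 \<noteq> 0" using x0(1) by auto
  ultimately have "l \<le> spectral_radius (transpose A ** A)"
    by (rule real_eigenvalue_le_spectral_radius[rotated])
  then show ?thesis using le[of x] by (meson mult_right_mono order_trans zero_le_power2)
qed

section \<open>Projection onto a ball\<close>

text \<open>The metric projection onto the ball of radius \<open>1 / b\<close>, for \<open>0 < b\<close>.\<close>

definition clip :: "real \<Rightarrow> 'a::real_normed_vector \<Rightarrow> 'a" where
  "clip b x = x /\<^sub>R max 1 (b * norm x)"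

lemma shrink_eq_diff_clip:
  assumes "0 < b"
  shows "shrink b x = x - clip b x"
proof (cases "b * norm x \<le> 1")
  case True
  then have "max (norm x - 1 / b) 0 = 0" using assms by (simp add: field_simps)
  then show ?thesis using True by (simp add: shrink_def clip_def max_def)
next
  case False
  then have "max (norm x - 1 / b) 0 = norm x - 1 / b" "x \<noteq> 0"
    using assms by (auto simp: field_simps)
  then have "shrink b x = ((norm x - 1 / b) / norm x) *\<^sub>R x"
    by (simp add: shrink_def divide_inverse)
  also have "(norm x - 1 / b) / norm x = 1 - 1 / (b * norm x)"
    using assms \<open>x \<noteq> 0\<close> by (simp add: field_simps)
  finally show ?thesis using False by (simp add: clip_def scaleR_left_diff_distrib divide_inverse)
qed

lemma eq_scaled_clip: "x = max 1 (b * norm x) *\<^sub>R clip b x"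
  by (simp add: clip_def)

lemma norm_clip_le:
  shows "b * norm (clip b x) \<le> 1"
proof -
  have "b * norm x / max 1 (b * norm x) \<le> 1" by (simp add: pos_divide_le_eq)
  then show ?thesis by (simp add: clip_def divide_inverse mult_ac)
qed

lemma clip_scaled_boundary:
  assumes "b * norm z = 1" "1 \<le> l"
  shows "clip b (l *\<^sub>R z) = z"
proof -
  have "b * norm (l *\<^sub>R z) = l"
    using assms by (simp add: algebra_simps)
  then have "clip b (l *\<^sub>R z) = (l *\<^sub>R z) /\<^sub>R l"
    using assms(2) by (simp only: clip_def max.absorb2)
  then show ?thesis using assms(2) by simp
qed

text \<open>Equality in the Cauchy-Schwarz bound \<open>b * (clip b x \<bullet> w) \<le> norm w\<close> at \<open>w = x - clip b x\<close>: both
  vectors point in the direction of \<open>x\<close>, and \<open>clip b x\<close> has norm \<open>1 / b\<close> unless \<open>w = 0\<close>.\<close>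

lemma norm_diff_clip:
  fixes x :: "'a::real_inner"
  assumes "0 < b"
  shows "norm (x - clip b x) = b * (clip b x \<bullet> (x - clip b x))"
proof -
  let ?l = "max 1 (b * norm x)"
  have d: "x - clip b x = (?l - 1) *\<^sub>R clip b x"
    by (subst (1) eq_scaled_clip[of x b]) (simp add: scaleR_left_diff_distrib)
  show ?thesis
  proof (cases "b * norm x \<le> 1")
    case True
    then show ?thesis by (simp add: clip_def)
  next
    case False
    then have n: "b * norm (clip b x) = 1" using assms by (auto simp: clip_def max_def field_simps)
    then have "norm (clip b x) = b * (norm (clip b x))\<^sup>2"
      by (metis mult.assoc mult.left_neutral power2_eq_square)
    then show ?thesis unfolding d
      by (simp add: power2_norm_eq_inner[symmetric])
  qed
qed

text \<open>If the difference quotients of the projection tend to \<open>0\<close> along directions converging to \<open>p\<close>, then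
  the projection is constant on a short segment in direction \<open>p\<close>. The reason is the polar form
  \<open>x = l x *\<^sub>R clip b x\<close> with \<open>l x = max 1 (b * norm x)\<close>: when \<open>clip\<close> does not change to first
  order, only the factor \<open>l\<close> can, so \<open>p\<close> is a multiple of \<open>clip b x\<close>. Inside the ball \<open>l\<close> is
  constant and \<open>p = 0\<close>; on the sphere \<open>l\<close> can only grow, so \<open>p\<close> points outwards; outside, both
  signs are harmless.\<close>

lemma clip_locally_constant_on_flat_ray:
  fixes x p :: "'a::real_inner"
  assumes b: "0 < b"
    and t: "\<And>j. 0 < t j" "t \<longlonglongrightarrow> 0"
    and d: "d \<longlonglongrightarrow> p"
    and flat: "(\<lambda>j. (clip b (x + t j *\<^sub>R d j) - clip b x) /\<^sub>R t j) \<longlonglongrightarrow> 0"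
  shows "\<forall>\<^sub>F s in at_right 0. clip b (x + s *\<^sub>R p) = clip b x"
proof -
  define l where "l y = max 1 (b * norm y)" for y :: 'a
  define z where "z = clip b x"
  define a where "a j = (l (x + t j *\<^sub>R d j) - l x) / t j" for j
  have lz: "y = l y *\<^sub>R clip b y" for y
    unfolding l_def by (rule eq_scaled_clip)
  have y_lim: "(\<lambda>j. x + t j *\<^sub>R d j) \<longlonglongrightarrow> x"
    using tendsto_add[OF tendsto_const[of x] tendsto_scaleR[OF t(2) d]] by simp
  have l_lim: "(\<lambda>j. l (x + t j *\<^sub>R d j)) \<longlonglongrightarrow> l x"
    unfolding l_def by (intro tendsto_intros y_lim)
  \<comment> \<open>The part of \<open>d j\<close> that changes the projection tends to \<open>0\<close>; what remains is radial.\<close>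
  have "(\<lambda>j. d j - l (x + t j *\<^sub>R d j) *\<^sub>R ((clip b (x + t j *\<^sub>R d j) - clip b x) /\<^sub>R t j))
      \<longlonglongrightarrow> p - l x *\<^sub>R 0"
    by (intro tendsto_intros d l_lim flat)
  moreover have "d j - l (x + t j *\<^sub>R d j) *\<^sub>R ((clip b (x + t j *\<^sub>R d j) - clip b x) /\<^sub>R t j)
      = a j *\<^sub>R z" for j
  proof -
    let ?y = "x + t j *\<^sub>R d j"
    have "t j *\<^sub>R d j = ?y - x" by simp
    also have "\<dots> = l ?y *\<^sub>R (clip b ?y - z) + (l ?y - l x) *\<^sub>R z"
      using lz[of ?y] lz[of x] unfolding z_def[symmetric]
      by (metis (no_types, lifting) diff_add_eq diff_diff_eq2 diff_add_cancel scaleR_left_diff_distrib scaleR_right_diff_distrib add_diff_eq)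
    finally have "d j = inverse (t j) *\<^sub>R (l ?y *\<^sub>R (clip b ?y - z) + (l ?y - l x) *\<^sub>R z)"
      using t(1)[of j] by (metis scaleR_left_diff_distrib divideR_right less_irrefl)
    then show ?thesis
      by (simp add: a_def z_def scaleR_add_right divide_inverse mult.commute algebra_simps)
  qed
  ultimately have az: "(\<lambda>j. a j *\<^sub>R z) \<longlonglongrightarrow> p" by simp
  show ?thesis
  proof (cases "b * norm x < 1")
    case True
    have "(\<lambda>j. b * norm (x + t j *\<^sub>R d j)) \<longlonglongrightarrow> b * norm x"
      by (intro tendsto_intros y_lim)
    then have "\<forall>\<^sub>F j in sequentially. b * norm (x + t j *\<^sub>R d j) < 1"
      using True by (rule order_tendstoD)
    then have "\<forall>\<^sub>F j in sequentially. a j *\<^sub>R z = 0"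
      by eventually_elim (use True in \<open>simp add: a_def l_def\<close>)
    then have "p = 0" using az by (metis LIMSEQ_unique tendsto_eventually)
    then show ?thesis by simp
  next
    case False
    then have nz: "b * norm z = 1" using b by (auto simp: z_def clip_def max_def field_simps)
    have zz: "z \<bullet> z \<noteq> 0" using nz by (auto simp del: inner_eq_zero_iff simp: inner_eq_zero_iff)
    define c where "c = (p \<bullet> z) / (z \<bullet> z)"
    have "(\<lambda>j. (a j *\<^sub>R z) \<bullet> z / (z \<bullet> z)) \<longlonglongrightarrow> c"
      unfolding c_def using zz by (intro tendsto_intros az) auto
    then have ac: "a \<longlonglongrightarrow> c" using zz by simp
    then have p: "p = c *\<^sub>R z"
      using az tendsto_scaleR[OF ac tendsto_const[of z]] LIMSEQ_unique by blast
    have "\<forall>\<^sub>F s in at_right 0. 1 \<le> l x + s * c"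
    proof (cases "l x = 1")
      case True
      have "0 \<le> c"
        using ac by (rule LIMSEQ_le_const)
          (use True t(1) in \<open>auto simp: a_def l_def intro!: divide_nonneg_pos\<close>)
      then show ?thesis
        by (intro eventually_mono[OF eventually_at_right_less[of 0]]) (simp add: True)
    next
      case False
      then have "1 < l x" by (auto simp: l_def)
      moreover have "((\<lambda>s. l x + s * c) \<longlongrightarrow> l x + 0 * c) (at_right 0)"
        by (intro tendsto_intros)
      ultimately have "\<forall>\<^sub>F s in at_right 0. 1 < l x + s * c"
        by (intro order_tendstoD(1)[where y = "l x + 0 * c"]) auto
      then show ?thesis by eventually_elim simp
    qed
    then show ?thesis
    proof eventually_elim
      case (elim s)
      have "x + s *\<^sub>R p = (l x + s * c) *\<^sub>R z"
        using lz[of x] by (simp add: p z_def[symmetric] scaleR_left_distrib)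
      then show ?case using clip_scaled_boundary[OF nz elim] by (simp add: z_def)
    qed
  qed
qed

section \<open>Abstract shrinkage\<close>

text \<open>\<open>R\<close> is the support function of a convex set multiplied by \<open>\<beta>\<close>, and \<open>P\<close> is the projection onto that set:
  the first two conditions on \<open>P\<close> and \<open>R\<close> say that \<open>\<beta> *\<^sub>R P x\<close> is a subgradient of \<open>R\<close> at
  \<open>x - P x\<close>, i.e. that \<open>x - P x\<close> is the proximal point of \<open>R / \<beta>\<close> at \<open>x\<close>. The last condition is a property of
  the boundary of the set, not of convex projections in general; it is what the linear rate
  rests on.\<close>

locale prox_pair =
  fixes R :: "'w::euclidean_space \<Rightarrow> real" and P :: "'w \<Rightarrow> 'w" and \<beta> :: real
  assumes beta_pos: "0 < \<beta>"
    and dual_feasible: "\<beta> * (P x \<bullet> w) \<le> R w"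
    and dual_attained: "R (x - P x) = \<beta> * (P x \<bullet> (x - P x))"
    and norm_le_R: "norm w \<le> R w"
    and locally_constant_on_flat_ray:
      "\<lbrakk>\<And>j. 0 < t j; t \<longlonglongrightarrow> 0; d \<longlonglongrightarrow> p;
        (\<lambda>j. (P (x + t j *\<^sub>R d j) - P x) /\<^sub>R t j) \<longlonglongrightarrow> 0\<rbrakk>
       \<Longrightarrow> \<forall>\<^sub>F s in at_right 0. P (x + s *\<^sub>R p) = P x"
begin

lemma prox_subgradient: "R (x - P x) + \<beta> * (P x \<bullet> (w - (x - P x))) \<le> R w"
  using dual_feasible[of x w] dual_attained[of x] by (simp add: inner_diff_right algebra_simps)

lemma firmly_nonexpansive:
  "(norm (P x - P y))\<^sup>2 + (norm ((x - P x) - (y - P y)))\<^sup>2 \<le> (norm (x - y))\<^sup>2"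
proof -
  have "\<beta> * (P y \<bullet> (x - P x)) \<le> \<beta> * (P x \<bullet> (x - P x))"
    "\<beta> * (P x \<bullet> (y - P y)) \<le> \<beta> * (P y \<bullet> (y - P y))"
    using dual_feasible dual_attained by metis+
  then have "P y \<bullet> (x - P x) \<le> P x \<bullet> (x - P x)" "P x \<bullet> (y - P y) \<le> P y \<bullet> (y - P y)"
    using beta_pos by simp_all
  then have "0 \<le> (P x - P y) \<bullet> ((x - P x) - (y - P y))"
    by (simp add: inner_diff_left inner_diff_right)
  moreover have "(norm (x - y))\<^sup>2 = (norm ((P x - P y) + 1 *\<^sub>R ((x - P x) - (y - P y))))\<^sup>2"
    by simp
  ultimately show ?thesis unfolding norm_add_scaleR_sq by simp
qed

lemma nonexpansive: "norm (P x - P y) \<le> norm (x - y)"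
proof -
  have "(norm (P x - P y))\<^sup>2 \<le> (norm (x - y))\<^sup>2"
    using firmly_nonexpansive[of x y] by (smt (verit) zero_le_power2)
  then show ?thesis by (rule power2_le_imp_le) simp
qed

lemma continuous_on_P: "continuous_on S P"
  by (rule continuous_on_subset[of UNIV])
    (auto intro!: lipschitz_on_continuous_on[of 1] lipschitz_onI simp: dist_norm nonexpansive)

lemma tendsto_P: "(g \<longlongrightarrow> l) F \<Longrightarrow> ((\<lambda>x. P (g x)) \<longlongrightarrow> P l) F"
  using continuous_on_tendsto_compose[OF continuous_on_P[of UNIV]] by force

lemma prox_minimal:
  "R (x - P x) + \<beta> / 2 * (norm (P x))\<^sup>2 \<le> R w + \<beta> / 2 * (norm (w - x))\<^sup>2"
proof -
  have "w - x = - P x + 1 *\<^sub>R (w - (x - P x))" by simp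
  then have "(norm (w - x))\<^sup>2 = (norm (P x))\<^sup>2 - 2 * (P x \<bullet> (w - (x - P x))) + (norm (w - (x - P x)))\<^sup>2"
    by (simp only: norm_add_scaleR_sq) simp
  then have "\<beta> / 2 * (norm (w - x))\<^sup>2 = \<beta> / 2 * (norm (P x))\<^sup>2 - \<beta> * (P x \<bullet> (w - (x - P x)))
      + \<beta> / 2 * (norm (w - (x - P x)))\<^sup>2"
    by (simp only: distrib_left right_diff_distrib)
  moreover have "0 \<le> \<beta> / 2 * (norm (w - (x - P x)))\<^sup>2" using beta_pos by simp
  ultimately show ?thesis using prox_subgradient[of x w] by linarith
qed

end

section \<open>One step of the iteration\<close>

locale splitting = prox_pair R P \<beta>
  for R :: "real ^ 'q \<Rightarrow> real" and P :: "real ^ 'q \<Rightarrow> real ^ 'q" and \<beta> :: real +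
  fixes D :: "real ^ 'p ^ 'q" and A :: "real ^ 'p ^ 'm" and f :: "real ^ 'm" and \<mu> \<tau> :: real
  assumes mu_pos: "0 < \<mu>"
    and tau_pos: "0 < \<tau>"
    and tau_less: "\<tau> < 2 / spectral_radius (transpose A ** A)"
    and null_spaces: "null_space A \<inter> null_space D = {0}"
begin

definition objective :: "real ^ 'q \<Rightarrow> real ^ 'p \<Rightarrow> real" where
  "objective w u = R w + \<beta> / 2 * (norm (w - D *v u))\<^sup>2 + \<mu> / 2 * (norm (A *v u - f))\<^sup>2"

text \<open>A relation instead of a function: the estimates test the linear system with the difference of two
  solutions, so the system itself is the convenient form of a step.\<close>

definition step :: "real ^ 'p \<Rightarrow> real ^ 'p \<Rightarrow> bool" where
  "step u u' \<longleftrightarrow>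
    (transpose D ** D + (\<mu> / (\<beta> * \<tau>)) *\<^sub>R mat 1) *v u' =
      transpose D *v (D *v u - P (D *v u)) + (\<mu> / (\<beta> * \<tau>)) *\<^sub>R (u - \<tau> *\<^sub>R fidelity_grad A f u)"

text \<open>The gradient of \<open>u \<mapsto> objective (D *v u - P (D *v u)) u\<close>, the objective minimized over \<open>w\<close>.\<close>

definition reduced_gradient :: "real ^ 'p \<Rightarrow> real ^ 'p" where
  "reduced_gradient u = \<beta> *\<^sub>R (transpose D *v P (D *v u)) + \<mu> *\<^sub>R fidelity_grad A f u"

definition c :: real where "c = \<mu> / (\<beta> * \<tau>)"

definition \<kappa> :: real where "\<kappa> = c * (\<tau> * (2 - \<tau> * spectral_radius (transpose A ** A)))"

text \<open>The norm of the matrix \<open>transpose D ** D + c *\<^sub>R mat 1\<close> of the linear system, written as the norm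
  of a pair so that its norm properties are inherited.\<close>

definition N :: "real ^ 'p \<Rightarrow> real" where
  "N x = norm (D *v x, sqrt c *\<^sub>R x)"

lemma c_pos: "0 < c"
  using mu_pos beta_pos tau_pos by (simp add: c_def)

lemma spectral_radius_pos: "0 < spectral_radius (transpose A ** A)"
proof (rule ccontr)
  assume "\<not> ?thesis"
  then have "2 / spectral_radius (transpose A ** A) \<le> 0" by (simp add: divide_nonneg_nonpos)
  then show False using tau_pos tau_less by linarith
qed

lemma kappa_pos: "0 < \<kappa>"
  using tau_less spectral_radius_pos c_pos tau_pos by (simp add: \<kappa>_def field_simps)

lemma N_sq: "(N x)\<^sup>2 = (norm (D *v x))\<^sup>2 + c * (norm x)\<^sup>2"
  using c_pos by (simp add: N_def norm_Pair power_mult_distrib)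

lemma is_norm_N: "is_norm N"
  unfolding is_norm_def
proof (intro conjI allI)
  fix a :: real and x y :: "real ^ 'p"
  show "0 \<le> N x" by (simp add: N_def)
  show "N x = 0 \<longleftrightarrow> x = 0" using c_pos by (auto simp: N_def zero_prod_def)
  have "N (a *\<^sub>R x) = norm (a *\<^sub>R (D *v x, sqrt c *\<^sub>R x))"
    by (simp add: N_def matrix_vector_mult_scaleR mult.commute)
  then show "N (a *\<^sub>R x) = \<bar>a\<bar> * N x" by (simp only: norm_scaleR N_def)
  have "N (x + y) = norm ((D *v x, sqrt c *\<^sub>R x) + (D *v y, sqrt c *\<^sub>R y))"
    by (simp add: N_def matrix_vector_right_distrib scaleR_add_right)
  then show "N (x + y) \<le> N x + N y" using norm_triangle_ineq by (simp only: N_def)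
qed

lemmas N_nonneg = is_norm_N[unfolded is_norm_def, THEN conjunct1, rule_format]
  and N_zero_iff = is_norm_N[unfolded is_norm_def, THEN conjunct2, THEN conjunct1, rule_format]
  and N_scaleR = is_norm_N[unfolded is_norm_def, THEN conjunct2, THEN conjunct2, THEN conjunct1, rule_format]

lemma N_minus: "N (- x) = N x"
  using N_scaleR[of "-1" x] by simp

lemma continuous_on_N: "continuous_on S N"
  unfolding N_def
  by (intro continuous_intros linear_continuous_on_compose[OF _ matrix_vector_mul_linear])

lemma tendsto_N: "(g \<longlongrightarrow> l) F \<Longrightarrow> ((\<lambda>x. N (g x)) \<longlongrightarrow> N l) F"
  using continuous_on_tendsto_compose[OF continuous_on_N[of UNIV]] by force

lemma tendsto_mat:
  fixes M :: "real ^ 'a ^ 'b"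
  shows "(g \<longlongrightarrow> l) F \<Longrightarrow> ((\<lambda>x. M *v g x) \<longlongrightarrow> M *v l) F"
  by (rule bounded_linear.tendsto[OF matrix_vector_mul_bounded_linear])

lemma norm_le_N: "sqrt c * norm x \<le> N x"
  using c_pos norm_snd_le[of "sqrt c *\<^sub>R x" "D *v x"] by (simp add: N_def)

lemma N_le_norm: obtains K where "0 < K" "\<And>x. N x \<le> K * norm x"
proof -
  have "linear (\<lambda>x. (D *v x, sqrt c *\<^sub>R x))"
    by (intro linearI) (simp_all add: matrix_vector_right_distrib matrix_vector_mult_scaleR scaleR_add_right)
  from linear_bounded_pos[OF this] obtain K where
    "0 < K" "\<And>x. norm (D *v x, sqrt c *\<^sub>R x) \<le> K * norm x" by blast
  then show thesis using that by (simp add: N_def)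
qed

lemma step_iff:
  "step u u' \<longleftrightarrow> transpose D *v (D *v u') + c *\<^sub>R u' =
    transpose D *v (D *v u - P (D *v u)) + c *\<^sub>R (u - \<tau> *\<^sub>R fidelity_grad A f u)"
  by (simp add: step_def c_def matrix_vector_mult_add_rdistrib matrix_vector_mul_assoc
      scaleR_matrix_vector_assoc[symmetric])

text \<open>A gradient step on the fidelity term does not increase distances, with a gain controlled by
  \<open>A *v e\<close>: expanding the square gives \<open>- 2 * \<tau> * (norm (A *v e))\<^sup>2 + \<tau>\<^sup>2 * (norm (transpose A *v (A *v e)))\<^sup>2\<close>,
  and the last term is at most \<open>\<tau>\<^sup>2\<close> times the spectral radius times \<open>(norm (A *v e))\<^sup>2\<close>.\<close>

lemma norm_gradient_step_sq:
  "c * (norm (e - \<tau> *\<^sub>R (transpose A *v (A *v e))))\<^sup>2 + \<kappa> * (norm (A *v e))\<^sup>2 \<le> c * (norm e)\<^sup>2"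
proof -
  let ?L = "spectral_radius (transpose A ** A)" and ?z = "transpose A *v (A *v e)"
  have "(norm ?z)\<^sup>2 \<le> ?L * (norm (A *v e))\<^sup>2"
  proof -
    have "(norm ?z)\<^sup>2 = (A *v e) \<bullet> (A *v ?z)"
      by (simp add: power2_norm_eq_inner inner_transpose_matrix)
    also have "\<dots> \<le> norm (A *v e) * norm (A *v ?z)" by (rule norm_cauchy_schwarz)
    finally have "((norm ?z)\<^sup>2)\<^sup>2 \<le> (norm (A *v e) * norm (A *v ?z))\<^sup>2"
      by (intro power_mono) auto
    also have "\<dots> \<le> (norm (A *v e))\<^sup>2 * (?L * (norm ?z)\<^sup>2)"
      unfolding power_mult_distrib by (intro mult_left_mono norm_mult_sq_le_spectral_radius) auto
    finally have "(norm ?z)\<^sup>2 * (norm ?z)\<^sup>2 \<le> (?L * (norm (A *v e))\<^sup>2) * (norm ?z)\<^sup>2"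
      unfolding power2_eq_square[of "(norm ?z)\<^sup>2"] by (simp only: mult_ac)
    then show ?thesis
      using spectral_radius_pos mult_right_le_imp_le[of "(norm ?z)\<^sup>2" "(norm ?z)\<^sup>2"]
      by (cases "?z = 0") auto
  qed
  then have "\<tau>\<^sup>2 * (norm ?z)\<^sup>2 \<le> \<tau>\<^sup>2 * (?L * (norm (A *v e))\<^sup>2)"
    by (intro mult_left_mono) auto
  moreover have "(norm (e + (- \<tau>) *\<^sub>R ?z))\<^sup>2 = (norm e)\<^sup>2 - 2 * \<tau> * (norm (A *v e))\<^sup>2 + \<tau>\<^sup>2 * (norm ?z)\<^sup>2"
    unfolding norm_add_scaleR_sq
    by (simp add: inner_transpose_matrix_right power2_norm_eq_inner)
  ultimately have "(norm (e - \<tau> *\<^sub>R ?z))\<^sup>2 + \<tau> * (2 - \<tau> * ?L) * (norm (A *v e))\<^sup>2 \<le> (norm e)\<^sup>2"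
    by (simp add: algebra_simps power2_eq_square)
  then have "c * ((norm (e - \<tau> *\<^sub>R ?z))\<^sup>2 + \<tau> * (2 - \<tau> * ?L) * (norm (A *v e))\<^sup>2) \<le> c * (norm e)\<^sup>2"
    using c_pos by (intro mult_left_mono) auto
  then show ?thesis by (simp add: \<kappa>_def algebra_simps)
qed

text \<open>Testing the linear system for the difference \<open>e'\<close> of the new points with \<open>e'\<close> itself, and
  Young's inequality, bound \<open>(N e')\<^sup>2\<close> by the squared differences of the two terms on the right-hand
  side; each of these is bounded with a gain.\<close>

lemma step_energy:
  assumes "step u u'" "step v v'"
  shows "(N (u' - v'))\<^sup>2 + (norm (P (D *v u) - P (D *v v)))\<^sup>2 + \<kappa> * (norm (A *v (u - v)))\<^sup>2
    \<le> (N (u - v))\<^sup>2"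
proof -
  define e e' where "e = u - v" and "e' = u' - v'"
  define s where "s = (D *v u - P (D *v u)) - (D *v v - P (D *v v))"
  define b where "b = e - \<tau> *\<^sub>R (transpose A *v (A *v e))"
  have lin: "transpose D *v (D *v e') + c *\<^sub>R e' = transpose D *v s + c *\<^sub>R b"
  proof -
    let ?rhs = "\<lambda>u. transpose D *v (D *v u - P (D *v u)) + c *\<^sub>R (u - \<tau> *\<^sub>R fidelity_grad A f u)"
    have "transpose D *v (D *v e') + c *\<^sub>R e'
        = (transpose D *v (D *v u') + c *\<^sub>R u') - (transpose D *v (D *v v') + c *\<^sub>R v')"
      by (simp add: e'_def matrix_vector_mult_diff_distrib scaleR_diff_right)
    also have "\<dots> = ?rhs u - ?rhs v" using assms by (simp only: step_iff)
    also have "\<dots> = transpose D *v s + c *\<^sub>R b"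
      by (simp add: s_def b_def e_def fidelity_grad_def matrix_vector_mult_diff_distrib algebra_simps)
    finally show ?thesis .
  qed
  have "(N e')\<^sup>2 = (transpose D *v (D *v e') + c *\<^sub>R e') \<bullet> e'"
    by (simp add: N_sq inner_add_left inner_transpose_matrix power2_norm_eq_inner)
  also have "\<dots> = s \<bullet> (D *v e') + c * (b \<bullet> e')"
    unfolding lin by (simp add: inner_add_left inner_transpose_matrix)
  also have "\<dots> \<le> ((norm s)\<^sup>2 + (norm (D *v e'))\<^sup>2) / 2 + c * (((norm b)\<^sup>2 + (norm e')\<^sup>2) / 2)"
  proof -
    have young: "x \<bullet> y \<le> ((norm x)\<^sup>2 + (norm y)\<^sup>2) / 2" for x y :: "'z::real_inner"
      using zero_le_power2[of "norm (x + (-1) *\<^sub>R y)"] unfolding norm_add_scaleR_sq by simp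
    show ?thesis using c_pos by (intro add_mono mult_left_mono young) auto
  qed
  finally have 1: "(N e')\<^sup>2 \<le> (norm s)\<^sup>2 + c * (norm b)\<^sup>2"
    by (simp add: N_sq field_simps)
  have 2: "(norm (P (D *v u) - P (D *v v)))\<^sup>2 + (norm s)\<^sup>2 \<le> (norm (D *v e))\<^sup>2"
    using firmly_nonexpansive[of "D *v u" "D *v v"]
    by (simp add: s_def e_def matrix_vector_mult_diff_distrib)
  from 1 2 norm_gradient_step_sq[of e, folded b_def] show ?thesis
    unfolding e_def[symmetric] e'_def[symmetric] N_sq[of e] by linarith
qed

lemma step_self_iff: "step p p \<longleftrightarrow> reduced_gradient p = 0"
proof -
  have ct: "c * \<tau> = \<mu> / \<beta>" using tau_pos by (simp add: c_def)
  have "step p p \<longleftrightarrow> transpose D *v P (D *v p) + (c * \<tau>) *\<^sub>R fidelity_grad A f p = 0"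
    unfolding step_iff
    by (simp add: matrix_vector_mult_diff_distrib scaleR_diff_right eq_diff_eq algebra_simps)
  also have "\<dots> \<longleftrightarrow> \<beta> *\<^sub>R (transpose D *v P (D *v p) + (c * \<tau>) *\<^sub>R fidelity_grad A f p) = 0"
    using beta_pos by simp
  also have "\<beta> *\<^sub>R (transpose D *v P (D *v p) + (c * \<tau>) *\<^sub>R fidelity_grad A f p) = reduced_gradient p"
    using beta_pos by (simp add: ct reduced_gradient_def scaleR_add_right)
  finally show ?thesis .
qed

section \<open>Stationary points are the minimizers\<close>

lemma reduced_gradient_cong:
  assumes "P (D *v u) = P (D *v v)" "A *v u = A *v v"
  shows "reduced_gradient u = reduced_gradient v"
  using assms by (simp add: reduced_gradient_def fidelity_grad_def)

text \<open>The objective is convex; its linear lower bound at \<open>(D *v u - P (D *v u), u)\<close> has no component in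
  \<open>w\<close> because \<open>\<beta> *\<^sub>R P\<close> is a subgradient of \<open>R\<close>, and its component in \<open>u\<close> is \<open>reduced_gradient u\<close>.\<close>

lemma objective_minimal_if_stationary:
  assumes "reduced_gradient u = 0"
  shows "objective (D *v u - P (D *v u)) u \<le> objective w' u'"
proof -
  define x where "x = D *v u"
  define q where "q = P x"
  define h where "h = u' - u"
  define g where "g = A *v u - f"
  have 1: "R (x - q) + \<beta> * (q \<bullet> (w' - (x - q))) \<le> R w'"
    unfolding q_def by (rule prox_subgradient)
  have "w' - D *v u' = - q + 1 *\<^sub>R ((w' - (x - q)) - D *v h)"
    by (simp add: x_def h_def matrix_vector_mult_diff_distrib)
  then have "(norm (w' - D *v u'))\<^sup>2 = (norm q)\<^sup>2 - 2 * (q \<bullet> ((w' - (x - q)) - D *v h))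
      + (norm ((w' - (x - q)) - D *v h))\<^sup>2"
    by (simp only: norm_add_scaleR_sq) simp
  then have "\<beta> / 2 * (norm (w' - D *v u'))\<^sup>2 \<ge> \<beta> / 2 * ((norm q)\<^sup>2 - 2 * (q \<bullet> ((w' - (x - q)) - D *v h)))"
    using beta_pos by (intro mult_left_mono) auto
  then have 2: "\<beta> / 2 * (norm (w' - D *v u'))\<^sup>2
      \<ge> \<beta> / 2 * (norm q)\<^sup>2 - \<beta> * (q \<bullet> (w' - (x - q))) + \<beta> * (q \<bullet> (D *v h))"
    by (simp add: inner_diff_right algebra_simps)
  have "A *v u' - f = g + 1 *\<^sub>R (A *v h)"
    by (simp add: g_def h_def matrix_vector_mult_diff_distrib)
  then have "(norm (A *v u' - f))\<^sup>2 = (norm g)\<^sup>2 + 2 * (g \<bullet> (A *v h)) + (norm (A *v h))\<^sup>2"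
    by (simp only: norm_add_scaleR_sq) simp
  then have "\<mu> / 2 * (norm (A *v u' - f))\<^sup>2 \<ge> \<mu> / 2 * ((norm g)\<^sup>2 + 2 * (g \<bullet> (A *v h)))"
    using mu_pos by (intro mult_left_mono) auto
  then have 3: "\<mu> / 2 * (norm (A *v u' - f))\<^sup>2 \<ge> \<mu> / 2 * (norm g)\<^sup>2 + \<mu> * (g \<bullet> (A *v h))"
    by (simp add: algebra_simps)
  have "reduced_gradient u \<bullet> h = \<beta> * (q \<bullet> (D *v h)) + \<mu> * (g \<bullet> (A *v h))"
    by (simp add: reduced_gradient_def fidelity_grad_def inner_add_left inner_transpose_matrix
        q_def x_def g_def)
  then have 4: "\<beta> * (q \<bullet> (D *v h)) + \<mu> * (g \<bullet> (A *v h)) = 0"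
    using assms by simp
  have "objective (x - q) u = R (x - q) + \<beta> / 2 * (norm q)\<^sup>2 + \<mu> / 2 * (norm g)\<^sup>2"
    by (simp add: objective_def x_def g_def)
  then show ?thesis
    using 1 2 3 4 unfolding objective_def[of w'] q_def x_def by linarith
qed

text \<open>With \<open>w\<close> kept at the value that is optimal for \<open>u\<close>, the objective along \<open>u + t *\<^sub>R h\<close> lies above the
  reduced objective and is quadratic in \<open>t\<close> with minimum at \<open>0\<close>, so its linear coefficient
  \<open>reduced_gradient u \<bullet> h\<close> is \<open>0\<close>. This avoids differentiating \<open>P\<close>.\<close>

lemma stationary_if_minimal:
  assumes "\<And>v. objective (D *v u - P (D *v u)) u \<le> objective (D *v v - P (D *v v)) v"
  shows "reduced_gradient u = 0"
proof -
  define q where "q = P (D *v u)"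
  define g where "g = A *v u - f"
  have "reduced_gradient u \<bullet> h = 0" for h
  proof -
    have "0 \<le> (\<beta> / 2 * (norm (D *v h))\<^sup>2 + \<mu> / 2 * (norm (A *v h))\<^sup>2) * t\<^sup>2 + (reduced_gradient u \<bullet> h) * t" for t
    proof -
      let ?v = "u + t *\<^sub>R h"
      have "objective (D *v u - q) u \<le> objective (D *v ?v - P (D *v ?v)) ?v"
        unfolding q_def by (rule assms)
      also have "\<dots> \<le> objective (D *v u - q) ?v"
        using prox_minimal[of "D *v ?v" "D *v u - q"] by (simp add: objective_def)
      finally have "\<beta> / 2 * (norm q)\<^sup>2 + \<mu> / 2 * (norm g)\<^sup>2
          \<le> \<beta> / 2 * (norm (D *v u - q - D *v ?v))\<^sup>2 + \<mu> / 2 * (norm (A *v ?v - f))\<^sup>2"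
        by (simp add: objective_def g_def)
      moreover have "norm (D *v u - q - D *v ?v) = norm (q + t *\<^sub>R (D *v h))"
        by (subst norm_minus_cancel[symmetric])
          (simp add: matrix_vector_right_distrib matrix_vector_mult_scaleR)
      moreover have "A *v ?v - f = g + t *\<^sub>R (A *v h)"
        by (simp add: g_def matrix_vector_right_distrib matrix_vector_mult_scaleR)
      ultimately have "0 \<le> \<beta> / 2 * (2 * t * (q \<bullet> (D *v h)) + t\<^sup>2 * (norm (D *v h))\<^sup>2)
          + \<mu> / 2 * (2 * t * (g \<bullet> (A *v h)) + t\<^sup>2 * (norm (A *v h))\<^sup>2)"
        by (simp add: norm_add_scaleR_sq algebra_simps add_divide_distrib)
      also have "\<dots> = (\<beta> / 2 * (norm (D *v h))\<^sup>2 + \<mu> / 2 * (norm (A *v h))\<^sup>2) * t\<^sup>2 + (reduced_gradient u \<bullet> h) * t"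
        by (simp add: reduced_gradient_def fidelity_grad_def inner_add_left inner_transpose_matrix
            q_def g_def algebra_simps)
      finally show ?thesis .
    qed
    then show ?thesis by (rule nonneg_quadratic_imp_linear_coeff_zero)
  qed
  then show ?thesis using inner_eq_zero_iff by blast
qed

text \<open>The reduced objective has bounded sublevel sets, because it bounds \<open>D *v u\<close> and \<open>A *v u\<close> and these
  two together determine \<open>u\<close>; hence it attains its minimum.\<close>

lemma stationary_point_exists: "\<exists>u. reduced_gradient u = 0"
proof -
  define E where "E u = objective (D *v u - P (D *v u)) u" for u
  have cont: "continuous_on UNIV E"
    unfolding E_def objective_def dual_attained
    by (intro continuous_intros continuous_on_compose2[OF continuous_on_P]
        linear_continuous_on_compose[OF _ matrix_vector_mul_linear]) auto
  have lin: "linear (\<lambda>u. (D *v u, A *v u))"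
    by (intro linearI) (simp_all add: matrix_vector_right_distrib matrix_vector_mult_scaleR)
  have "inj (\<lambda>u. (D *v u, A *v u))"
    unfolding linear_injective_0[OF lin]
    using null_spaces by (auto simp: null_space_def zero_prod_def)
  then obtain B where B: "0 < B" "\<And>u. B * norm u \<le> norm (D *v u, A *v u)"
    using linear_inj_bounded_below_pos[OF lin] by blast
  define S where "S = {u. E u \<le> E 0}"
  have "bounded S"
  proof (rule boundedI)
    fix u assume "u \<in> S"
    define C where "C = E 0"
    define w where "w = D *v u - P (D *v u)"
    have le: "R w + \<beta> / 2 * (norm (w - D *v u))\<^sup>2 + \<mu> / 2 * (norm (A *v u - f))\<^sup>2 \<le> C"
      using \<open>u \<in> S\<close> by (simp add: S_def E_def objective_def w_def C_def)
    have nn: "0 \<le> R w" "0 \<le> \<beta> / 2 * (norm (w - D *v u))\<^sup>2" "0 \<le> \<mu> / 2 * (norm (A *v u - f))\<^sup>2"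
      using order_trans[OF norm_ge_zero norm_le_R[of w]] beta_pos mu_pos by auto
    have "norm w \<le> C" using norm_le_R[of w] nn le by linarith
    moreover have "norm (w - D *v u) \<le> sqrt (2 * C / \<beta>)"
      using nn le beta_pos by (intro real_le_rsqrt) (simp add: field_simps)
    moreover have "norm (A *v u - f) \<le> sqrt (2 * C / \<mu>)"
      using nn le mu_pos by (intro real_le_rsqrt) (simp add: field_simps)
    moreover have "norm (D *v u) \<le> norm w + norm (w - D *v u)"
      using norm_triangle_ineq4[of w "w - D *v u"] by simp
    moreover have "norm (A *v u) \<le> norm (A *v u - f) + norm f"
      using norm_triangle_ineq[of "A *v u - f" f] by simp
    moreover have "B * norm u \<le> norm (D *v u) + norm (A *v u)"
      using B(2)[of u] norm_Pair_le[of "D *v u" "A *v u"] by linarith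
    ultimately have "B * norm u \<le> C + sqrt (2 * C / \<beta>) + sqrt (2 * C / \<mu>) + norm f"
      by linarith
    then show "norm u \<le> (E 0 + sqrt (2 * E 0 / \<beta>) + sqrt (2 * E 0 / \<mu>) + norm f) / B"
      using B(1) by (simp add: C_def field_simps)
  qed
  moreover have "closed S"
    unfolding S_def by (intro closed_Collect_le cont continuous_on_const)
  ultimately have "compact S" by (simp add: compact_eq_bounded_closed)
  moreover have "S \<noteq> {}" by (auto simp: S_def)
  ultimately obtain u where u: "u \<in> S" "\<And>v. v \<in> S \<Longrightarrow> E u \<le> E v"
    using continuous_attains_inf[OF _ _ continuous_on_subset[OF cont subset_UNIV], of S] by blast
  have "E u \<le> E v" for v
  proof (cases "v \<in> S")
    case False
    then have "E 0 < E v" by (simp add: S_def)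
    then show ?thesis using \<open>u \<in> S\<close> by (simp add: S_def)
  qed (rule u(2))
  then have "reduced_gradient u = 0"
    unfolding E_def by (rule stationary_if_minimal)
  then show ?thesis ..
qed

section \<open>Convergence and its rate\<close>

lemma fejer:
  assumes "\<And>k. step (u k) (u (Suc k))" "reduced_gradient p = 0"
  shows "decseq (\<lambda>k. N (u k - p))"
proof (rule decseq_SucI)
  fix k
  have "(N (u (Suc k) - p))\<^sup>2 \<le> (N (u k - p))\<^sup>2"
    using step_energy[OF assms(1)[of k], of p p] assms(2) kappa_pos
    by (smt (verit) mult_nonneg_nonneg step_self_iff zero_le_power2)
  then show "N (u (Suc k) - p) \<le> N (u k - p)"
    using N_nonneg by (rule power2_le_imp_le)
qed

lemma tendsto_of_N:
  assumes "(\<lambda>k. N (g k - l)) \<longlonglongrightarrow> 0"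
  shows "g \<longlonglongrightarrow> l"
proof -
  have le: "norm (g k - l) \<le> N (g k - l) / sqrt c" for k
    using norm_le_N[of "g k - l"] c_pos by (simp add: field_simps)
  have "(\<lambda>k. N (g k - l) / sqrt c) \<longlonglongrightarrow> 0"
    using tendsto_divide[OF assms tendsto_const[of "sqrt c"]] c_pos by simp
  then have "(\<lambda>k. g k - l) \<longlonglongrightarrow> 0"
    by (rule Lim_null_comparison[OF always_eventually[OF allI[OF le]]])
  then show ?thesis by (simp add: LIM_zero_iff)
qed

text \<open>Fejer monotonicity with respect to one stationary point \<open>p\<close> gives boundedness and makes the gains
  in \<open>step_energy\<close> tend to \<open>0\<close>. A cluster point thus shares \<open>P (D *v p)\<close> and \<open>A *v p\<close> with \<open>p\<close> and is
  stationary too; monotonicity with respect to the cluster point upgrades the subsequence to the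
  whole sequence.\<close>

lemma converges_to_stationary_point:
  assumes st: "\<And>k. step (u k) (u (Suc k))"
  shows "\<exists>l. u \<longlonglongrightarrow> l \<and> reduced_gradient l = 0"
proof -
  obtain p where p: "reduced_gradient p = 0" using stationary_point_exists by blast
  have dec: "decseq (\<lambda>k. N (u k - p))" using fejer[of u, OF st p] .
  then obtain r where r: "(\<lambda>k. N (u k - p)) \<longlonglongrightarrow> r"
    using decseq_convergent[of "\<lambda>k. N (u k - p)" 0] N_nonneg by blast
  have drop: "(\<lambda>k. (N (u k - p))\<^sup>2 - (N (u (Suc k) - p))\<^sup>2) \<longlonglongrightarrow> 0"
    using tendsto_diff[OF tendsto_power[OF r, of 2] tendsto_power[OF LIMSEQ_Suc[OF r], of 2]] by simp
  have en: "(norm (P (D *v u k) - P (D *v p)))\<^sup>2 + \<kappa> * (norm (A *v (u k - p)))\<^sup>2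
      \<le> (N (u k - p))\<^sup>2 - (N (u (Suc k) - p))\<^sup>2" for k
    using step_energy[OF st[of k], of p p] p by (simp add: step_self_iff)
  have "bounded (range u)"
  proof (rule boundedI)
    fix x assume "x \<in> range u"
    then obtain k where "x = u k" by blast
    have "sqrt c * norm (u k - p) \<le> N (u 0 - p)"
      using norm_le_N[of "u k - p"] decseqD[OF dec, of 0 k] by simp
    then have "norm (u k - p) \<le> N (u 0 - p) / sqrt c"
      using c_pos by (simp add: field_simps)
    then show "norm x \<le> N (u 0 - p) / sqrt c + norm p"
      using norm_triangle_ineq[of "u k - p" p] \<open>x = u k\<close> by simp
  qed
  then obtain l \<sigma> where \<sigma>: "strict_mono \<sigma>" "(u \<circ> \<sigma>) \<longlonglongrightarrow> l"
    using bounded_imp_convergent_subsequence by blast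
  have ul: "(\<lambda>j. u (\<sigma> j)) \<longlonglongrightarrow> l" using \<sigma>(2) by (simp add: comp_def)
  have drop': "(\<lambda>j. (N (u (\<sigma> j) - p))\<^sup>2 - (N (u (Suc (\<sigma> j)) - p))\<^sup>2) \<longlonglongrightarrow> 0"
    using LIMSEQ_subseq_LIMSEQ[OF drop \<sigma>(1)] by (simp add: comp_def)
  have "(\<lambda>j. (norm (P (D *v u (\<sigma> j)) - P (D *v p)))\<^sup>2 + \<kappa> * (norm (A *v (u (\<sigma> j) - p)))\<^sup>2)
      \<longlonglongrightarrow> (norm (P (D *v l) - P (D *v p)))\<^sup>2 + \<kappa> * (norm (A *v (l - p)))\<^sup>2"
    by (intro tendsto_intros tendsto_P tendsto_mat ul)
  then have "(norm (P (D *v l) - P (D *v p)))\<^sup>2 + \<kappa> * (norm (A *v (l - p)))\<^sup>2 \<le> 0"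
    using drop' by (rule LIMSEQ_le) (use en in blast)
  then have "P (D *v l) = P (D *v p)" "A *v (l - p) = 0"
    using kappa_pos by (smt (verit) mult_pos_pos norm_eq_zero mult_nonneg_nonneg right_minus_eq zero_le_power2 zero_less_power2)+
  then have l: "reduced_gradient l = 0"
    using p reduced_gradient_cong[of l p] by (simp add: matrix_vector_mult_diff_distrib)
  have "(\<lambda>j. N (u (\<sigma> j) - l)) \<longlonglongrightarrow> N (l - l)"
    by (intro tendsto_N tendsto_intros ul)
  then have sub: "((\<lambda>k. N (u k - l)) \<circ> \<sigma>) \<longlonglongrightarrow> 0"
    using N_zero_iff[of 0] by (simp add: comp_def)
  obtain r' where r': "(\<lambda>k. N (u k - l)) \<longlonglongrightarrow> r'"
    using decseq_convergent[OF fejer[of u, OF st l], of 0] N_nonneg by blast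
  then have "r' = 0"
    using LIMSEQ_subseq_LIMSEQ[OF r' \<sigma>(1)] sub LIMSEQ_unique by blast
  then show ?thesis using r' l tendsto_of_N by blast
qed

text \<open>The distance to the stationary point \<open>l + x\<close> decreases to \<open>N x\<close>, so it never drops below. A sequence
  converging to one stationary point cannot approach it closely along a direction of
  stationary points.\<close>

lemma error_stays_away_from_stationary_direction:
  assumes st: "\<And>k. step (u k) (u (Suc k))" and l: "u \<longlonglongrightarrow> l"
    and stat: "reduced_gradient (l + x) = 0"
  shows "N x \<le> N (u k - l - x)"
proof -
  have "(\<lambda>k. N (u k - (l + x))) \<longlonglongrightarrow> N (l - (l + x))"
    by (intro tendsto_N tendsto_intros l)
  then have "N (l - (l + x)) \<le> N (u k - (l + x))"
    using decseq_ge[OF fejer[of u, OF st stat]] by blast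
  then show ?thesis by (simp add: N_minus diff_diff_eq)
qed

text \<open>By contradiction: along a subsequence with rates tending to \<open>1\<close>, the gains in \<open>step_energy\<close> are of
  smaller order than the squared error, so a limit \<open>p\<close> of the normalized errors \<open>d\<close> is a direction
  of stationary points. The preceding lemma, applied with a step along \<open>p\<close> as long as the error
  itself, then keeps \<open>d\<close> away from \<open>p\<close>.\<close>

lemma q_linear:
  assumes st: "\<And>k. step (u k) (u (Suc k))" and l: "u \<longlonglongrightarrow> l" and res: "reduced_gradient l = 0"
  shows "q_linearly_convergent u l"
proof (rule ccontr)
  assume not: "\<not> q_linearly_convergent u l"
  \<comment> \<open>Any sequence in the open unit interval that tends to \<open>1\<close> would do.\<close>
  define \<rho> where "\<rho> j = 1 - 1 / (real j + 2)" for j :: nat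
  have \<rho>: "0 < \<rho> j" "\<rho> j < 1" for j by (auto simp: \<rho>_def field_simps)
  have "\<exists>k\<ge>j. \<rho> j * N (u k - l) < N (u (Suc k) - l)" for j
    using not is_norm_N \<rho>[of j] unfolding q_linearly_convergent_def by (meson not_le)
  then obtain \<sigma> where \<sigma>: "\<And>j. j \<le> \<sigma> j" "\<And>j. \<rho> j * N (u (\<sigma> j) - l) < N (u (Suc (\<sigma> j)) - l)"
    by metis
  define e where "e j = u (\<sigma> j) - l" for j
  define t where "t j = norm (e j)" for j
  have en: "(norm (P (D *v u k) - P (D *v l)))\<^sup>2 + \<kappa> * (norm (A *v (u k - l)))\<^sup>2
      \<le> (N (u k - l))\<^sup>2 - (N (u (Suc k) - l))\<^sup>2" for k
    using step_energy[OF st[of k], of l l] res by (simp add: step_self_iff)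
  have e_nz: "e j \<noteq> 0" for j
  proof
    assume "e j = 0"
    then have "N (u (Suc (\<sigma> j)) - l) \<le> 0" "N (u (\<sigma> j) - l) = 0"
      using decseqD[OF fejer[of u, OF st res], of "\<sigma> j" "Suc (\<sigma> j)"] N_zero_iff[of 0]
      by (auto simp: e_def)
    then show False using \<sigma>(2)[of j] by simp
  qed
  then have t_pos: "0 < t j" for j by (simp add: t_def)
  have \<sigma>_lim: "filterlim \<sigma> at_top sequentially"
    by (rule filterlim_at_top_mono[OF filterlim_ident]) (simp add: \<sigma>(1))
  have "(\<lambda>j. u (\<sigma> j)) \<longlonglongrightarrow> l" using filterlim_compose[OF l \<sigma>_lim] .
  then have t_lim: "t \<longlonglongrightarrow> 0"
    unfolding t_def e_def by (intro tendsto_norm_zero LIM_zero)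
  define d where "d j = e j /\<^sub>R t j" for j
  have norm_d: "norm (d j) = 1" for j
    using e_nz[of j] by (simp add: d_def t_def)
  have e_td: "e j = t j *\<^sub>R d j" for j
    using t_pos[of j] by (simp add: d_def)
  have "bounded (range d)" by (rule boundedI[of _ 1]) (auto simp: norm_d)
  then obtain p \<phi> where \<phi>: "strict_mono \<phi>" "(d \<circ> \<phi>) \<longlonglongrightarrow> p"
    using bounded_imp_convergent_subsequence by blast
  then have dp: "(\<lambda>j. d (\<phi> j)) \<longlonglongrightarrow> p" by (simp add: comp_def)
  have p1: "norm p = 1"
    using tendsto_norm[OF dp] by (simp add: norm_d LIMSEQ_const_iff)
  have tp: "(\<lambda>j. t (\<phi> j)) \<longlonglongrightarrow> 0"
    using LIMSEQ_subseq_LIMSEQ[OF t_lim \<phi>(1)] by (simp add: comp_def)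
  obtain K where K: "0 < K" "\<And>x. N x \<le> K * norm x" using N_le_norm by metis
  define q where "q j = (P (D *v l + t j *\<^sub>R (D *v d j)) - P (D *v l)) /\<^sub>R t j" for j
  have q_e: "P (D *v u (\<sigma> j)) - P (D *v l) = t j *\<^sub>R q j" for j
  proof -
    have "u (\<sigma> j) = l + t j *\<^sub>R d j" using e_td[of j] by (simp add: e_def algebra_simps)
    then have "D *v u (\<sigma> j) = D *v l + t j *\<^sub>R (D *v d j)"
      by (simp add: matrix_vector_right_distrib matrix_vector_mult_scaleR)
    then show ?thesis using t_pos[of j] by (simp add: q_def)
  qed
  have rate: "(norm (q j))\<^sup>2 + \<kappa> * (norm (A *v d j))\<^sup>2 \<le> K\<^sup>2 * (1 - (\<rho> j)\<^sup>2)" for j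
  proof -
    have "(\<rho> j * N (e j))\<^sup>2 \<le> (N (u (Suc (\<sigma> j)) - l))\<^sup>2"
      using \<sigma>(2)[of j] \<rho>(1)[of j] N_nonneg[of "e j"] by (intro power_mono) (auto simp: e_def)
    then have "(norm (t j *\<^sub>R q j))\<^sup>2 + \<kappa> * (norm (A *v e j))\<^sup>2 \<le> (N (e j))\<^sup>2 - (\<rho> j * N (e j))\<^sup>2"
      using en[of "\<sigma> j"] by (simp add: e_def[symmetric] q_e)
    also have "\<dots> = (N (e j))\<^sup>2 * (1 - (\<rho> j)\<^sup>2)" by (simp add: algebra_simps power_mult_distrib)
    also have "\<dots> \<le> (K * t j)\<^sup>2 * (1 - (\<rho> j)\<^sup>2)"
      using K(2)[of "e j"] N_nonneg[of "e j"] \<rho>[of j]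
      by (intro mult_right_mono power_mono) (auto simp: t_def power_le_one)
    finally have "(t j)\<^sup>2 * ((norm (q j))\<^sup>2 + \<kappa> * (norm (A *v d j))\<^sup>2) \<le> (t j)\<^sup>2 * (K\<^sup>2 * (1 - (\<rho> j)\<^sup>2))"
      by (simp add: e_td[of j] matrix_vector_mult_scaleR power_mult_distrib algebra_simps)
    then show ?thesis using t_pos[of j] by (simp add: mult_le_cancel_left)
  qed
  have "(\<lambda>j. 1 / (real j + 2)) \<longlonglongrightarrow> 0"
    using LIMSEQ_ignore_initial_segment[OF lim_1_over_n, of 2] by (simp add: add.commute)
  then have "(\<lambda>j. K\<^sup>2 * (1 - (\<rho> j)\<^sup>2)) \<longlonglongrightarrow> K\<^sup>2 * (1 - (1 - 0)\<^sup>2)"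
    unfolding \<rho>_def by (intro tendsto_intros)
  then have bnd: "(\<lambda>j. K\<^sup>2 * (1 - (\<rho> j)\<^sup>2)) \<longlonglongrightarrow> 0" by simp
  have "(\<lambda>j. (norm (q j))\<^sup>2) \<longlonglongrightarrow> 0"
    by (rule tendsto_sandwich[OF _ _ tendsto_const bnd])
      (use rate kappa_pos in \<open>auto intro!: always_eventually order_trans[OF _ rate]\<close>)
  then have q_lim: "q \<longlonglongrightarrow> 0"
    using tendsto_norm_zero_cancel tendsto_real_sqrt by fastforce
  have "(\<lambda>j. \<kappa> * (norm (A *v d j))\<^sup>2) \<longlonglongrightarrow> 0"
    by (rule tendsto_sandwich[OF _ _ tendsto_const bnd])
      (use rate kappa_pos in \<open>auto intro!: always_eventually order_trans[OF _ rate]\<close>)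
  then have "(\<lambda>j. \<kappa> * (norm (A *v d (\<phi> j)))\<^sup>2) \<longlonglongrightarrow> 0"
    using LIMSEQ_subseq_LIMSEQ[OF _ \<phi>(1)] by (fastforce simp: comp_def)
  moreover have "(\<lambda>j. \<kappa> * (norm (A *v d (\<phi> j)))\<^sup>2) \<longlonglongrightarrow> \<kappa> * (norm (A *v p))\<^sup>2"
    by (intro tendsto_intros tendsto_mat dp)
  ultimately have Ap: "A *v p = 0"
    using LIMSEQ_unique kappa_pos by fastforce
  \<comment> \<open>The gains were divided by the squared error, so \<open>P\<close> is flat to first order in direction \<open>D *v p\<close>.\<close>
  have "\<forall>\<^sub>F s in at_right 0. P (D *v l + s *\<^sub>R (D *v p)) = P (D *v l)"
  proof (rule locally_constant_on_flat_ray)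
    show "0 < t (\<phi> j)" for j by (rule t_pos)
    show "(\<lambda>j. t (\<phi> j)) \<longlonglongrightarrow> 0" by (rule tp)
    show "(\<lambda>j. D *v d (\<phi> j)) \<longlonglongrightarrow> D *v p" by (intro tendsto_mat dp)
    show "(\<lambda>j. (P (D *v l + t (\<phi> j) *\<^sub>R (D *v d (\<phi> j))) - P (D *v l)) /\<^sub>R t (\<phi> j)) \<longlonglongrightarrow> 0"
      using LIMSEQ_subseq_LIMSEQ[OF q_lim \<phi>(1)] by (simp add: comp_def q_def)
  qed
  then have stat: "\<forall>\<^sub>F s in at_right 0. reduced_gradient (l + s *\<^sub>R p) = 0"
  proof eventually_elim
    case (elim s)
    have "reduced_gradient (l + s *\<^sub>R p) = reduced_gradient l"
      using elim by (intro reduced_gradient_cong)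
        (simp_all add: matrix_vector_right_distrib matrix_vector_mult_scaleR Ap)
    then show ?case using res by simp
  qed
  have "filterlim (\<lambda>j. t (\<phi> j)) (at_right 0) sequentially"
    using tp by (rule filterlim_at_withinI) (simp add: t_pos less_imp_neq[symmetric])
  \<comment> \<open>The step length \<open>s\<close> is taken to be the current error \<open>t (\<phi> j)\<close>.\<close>
  from eventually_compose_filterlim[OF stat this]
  have "\<forall>\<^sub>F j in sequentially. N p \<le> N (d (\<phi> j) - p)"
  proof eventually_elim
    case (elim j)
    let ?t = "t (\<phi> j)"
    have "N (?t *\<^sub>R p) \<le> N (e (\<phi> j) - ?t *\<^sub>R p)"
      unfolding e_def by (rule error_stays_away_from_stationary_direction[OF st l elim])
    also have "e (\<phi> j) - ?t *\<^sub>R p = ?t *\<^sub>R (d (\<phi> j) - p)"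
      by (simp add: e_td scaleR_diff_right)
    finally show ?case using t_pos[of "\<phi> j"] by (simp add: N_scaleR)
  qed
  moreover have "(\<lambda>j. N (d (\<phi> j) - p)) \<longlonglongrightarrow> N (p - p)"
    by (intro tendsto_N tendsto_intros dp)
  ultimately have "N p \<le> N (p - p)"
    using tendsto_lowerbound by fastforce
  then have "p = 0" using N_zero_iff N_nonneg[of p] by (metis antisym diff_self)
  then show False using p1 by simp
qed

end
section \<open>Vectors in blocks of two\<close>

lemma block_component [simp]: "block w i $ 1 = w $ Inl i" "block w i $ 2 = w $ Inr i"
  by (simp_all add: block_def)

lemma linear_block: "linear (\<lambda>w. block w i)"
  by (intro linearI) (simp_all add: vec_eq_iff forall_2)

lemma inner_eq_sum_block:
  fixes x y :: "real ^ ('p::finite + 'p)"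
  shows "x \<bullet> y = (\<Sum>i\<in>UNIV. block x i \<bullet> block y i)"
proof -
  have "x \<bullet> y = (\<Sum>r\<in>UNIV <+> UNIV. x $ r * y $ r)"
    by (simp add: inner_vec_def UNIV_Plus_UNIV)
  also have "\<dots> = (\<Sum>i\<in>UNIV. x $ Inl i * y $ Inl i) + (\<Sum>i\<in>UNIV. x $ Inr i * y $ Inr i)"
    by (simp add: sum.Plus del: UNIV_Plus_UNIV)
  finally show ?thesis by (simp add: inner_vec_def sum_2 sum.distrib)
qed

lemma norm_sq_eq_sum_block:
  fixes x :: "real ^ ('p::finite + 'p)"
  shows "(norm x)\<^sup>2 = (\<Sum>i\<in>UNIV. (norm (block x i))\<^sup>2)"
  by (simp add: power2_norm_eq_inner inner_eq_sum_block)

lemma block_eq_iff: "x = y \<longleftrightarrow> (\<forall>i. block x i = block y i)"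
proof
  assume *: "\<forall>i. block x i = block y i"
  have "x $ r = y $ r" for r
    by (cases r) (metis * block_component)+
  then show "x = y" by (simp add: vec_eq_iff)
qed simp

lemma norm_le_sum_norm_block:
  fixes x :: "real ^ ('p::finite + 'p)"
  shows "norm x \<le> (\<Sum>i\<in>UNIV. norm (block x i))"
proof -
  have "norm x = L2_set (\<lambda>i. norm (block x i)) UNIV"
    unfolding L2_set_def by (metis norm_sq_eq_sum_block norm_ge_zero real_sqrt_unique)
  then show ?thesis by (simp add: L2_set_le_sum)
qed

lemma block_diff_op: "block (diff_op *v u) i = diff_at i *v u"
  by (simp add: vec_eq_iff forall_2 diff_op_def diff_at_def matrix_vector_mult_def)

definition clip_blocks :: "real \<Rightarrow> real ^ ('p::finite + 'p) \<Rightarrow> real ^ ('p + 'p)" where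
  "clip_blocks b x =
    (\<chi> r. case r of Inl i \<Rightarrow> clip b (block x i) $ 1 | Inr i \<Rightarrow> clip b (block x i) $ 2)"

lemma block_clip_blocks [simp]: "block (clip_blocks b x) i = clip b (block x i)"
  by (simp add: vec_eq_iff forall_2 clip_blocks_def)

text \<open>All conditions hold block by block; the finitely many short segments on which the blocks of the
  projection are constant have a common part.\<close>

lemma prox_pair_blocks:
  assumes b: "0 < b"
  shows "prox_pair (\<lambda>w. \<Sum>i\<in>UNIV. norm (block w (i :: 'p::finite))) (clip_blocks b) b"
proof
  note block_simps = linear_add[OF linear_block] linear_diff[OF linear_block]
    linear_scale[OF linear_block]
  show "0 < b" by (rule b)
  fix x w p :: "real ^ ('p + 'p)"
  show "b * (clip_blocks b x \<bullet> w) \<le> (\<Sum>i\<in>UNIV. norm (block w i))"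
    unfolding inner_eq_sum_block sum_distrib_left
  proof (rule sum_mono)
    fix i
    have "b * (clip b (block x i) \<bullet> block w i) \<le> b * (norm (clip b (block x i)) * norm (block w i))"
      using b norm_cauchy_schwarz by (intro mult_left_mono) auto
    also have "\<dots> \<le> 1 * norm (block w i)"
      unfolding mult.assoc[symmetric] by (intro mult_right_mono norm_clip_le) auto
    finally show "b * (block (clip_blocks b x) i \<bullet> block w i) \<le> norm (block w i)" by simp
  qed
  show "(\<Sum>i\<in>UNIV. norm (block (x - clip_blocks b x) i)) = b * (clip_blocks b x \<bullet> (x - clip_blocks b x))"
    by (simp add: inner_eq_sum_block sum_distrib_left block_simps norm_diff_clip[OF b])
  show "norm w \<le> (\<Sum>i\<in>UNIV. norm (block w i))" by (rule norm_le_sum_norm_block)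
  fix t :: "nat \<Rightarrow> real" and d :: "nat \<Rightarrow> real ^ ('p + 'p)"
  assume t: "\<And>j. 0 < t j" "t \<longlonglongrightarrow> 0" and d: "d \<longlonglongrightarrow> p"
    and flat: "(\<lambda>j. (clip_blocks b (x + t j *\<^sub>R d j) - clip_blocks b x) /\<^sub>R t j) \<longlonglongrightarrow> 0"
  have block_lim: "(\<lambda>j. block (g j) i) \<longlonglongrightarrow> block l i" if "g \<longlonglongrightarrow> l"
    for g and l :: "real ^ ('p + 'p)" and i
    using that linear_block[of i] linear_conv_bounded_linear bounded_linear.tendsto by blast
  have "\<forall>\<^sub>F s in at_right 0. clip b (block x i + s *\<^sub>R block p i) = clip b (block x i)" for i
  proof (rule clip_locally_constant_on_flat_ray[OF b t])
    show "(\<lambda>j. block (d j) i) \<longlonglongrightarrow> block p i" by (rule block_lim[OF d])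
    show "(\<lambda>j. (clip b (block x i + t j *\<^sub>R block (d j) i) - clip b (block x i)) /\<^sub>R t j) \<longlonglongrightarrow> 0"
      using block_lim[OF flat, of i] by (simp add: block_simps linear_0[OF linear_block])
  qed
  then have "\<forall>\<^sub>F s in at_right 0. \<forall>i. clip b (block x i + s *\<^sub>R block p i) = clip b (block x i)"
    by (rule eventually_all_finite)
  then show "\<forall>\<^sub>F s in at_right 0. clip_blocks b (x + s *\<^sub>R p) = clip_blocks b x"
    by eventually_elim (simp add: block_eq_iff block_simps)
qed

section \<open>The FTVCS iteration\<close>

theorem theorem2p3:
  fixes A :: "real ^ ('n::{finite,linorder}) pixel ^ 'm"
    and f :: "real ^ 'm"
    and \<mu> \<beta> \<tau> :: real
    and w :: "nat \<Rightarrow> real ^ ('n pixel + 'n pixel)"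
    and u :: "nat \<Rightarrow> real ^ 'n pixel"
  assumes "\<mu> > 0"
    and "null_space A \<inter> null_space (diff_op :: real ^ 'n pixel ^ ('n pixel + 'n pixel)) = {0}"
    and "\<beta> > 0"
    and "0 < \<tau>" and "\<tau> < 2 / spectral_radius (transpose A ** A)"
    and "ftvcs A f \<mu> \<beta> \<tau> w u"
  shows "\<exists>wstar ustar. w \<longlonglongrightarrow> wstar \<and> u \<longlonglongrightarrow> ustar
      \<and> is_arg_min (\<lambda>(w, u). penalized_objective A f \<mu> \<beta> w u) (\<lambda>_. True) (wstar, ustar)
      \<and> q_linearly_convergent u ustar"
proof -
  let ?R = "\<lambda>w :: real ^ ('n pixel + 'n pixel). \<Sum>i\<in>UNIV. norm (block w i)"
  let ?D = "diff_op :: real ^ 'n pixel ^ ('n pixel + 'n pixel)"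
  interpret prox_pair ?R "clip_blocks \<beta>" \<beta>
    by (rule prox_pair_blocks[OF assms(3)])
  interpret splitting ?R "clip_blocks \<beta>" \<beta> ?D A f \<mu> \<tau>
    using assms(1,2,4,5) by unfold_locales
  have objective_eq: "penalized_objective A f \<mu> \<beta> w' u' = objective w' u'" for w' u'
    by (simp add: penalized_objective_def objective_def norm_sq_eq_sum_block
        linear_diff[OF linear_block] block_diff_op sum.distrib sum_distrib_left)
  have w_Suc: "w (Suc k) = ?D *v u k - clip_blocks \<beta> (?D *v u k)" for k
    using assms(6) unfolding ftvcs_def block_eq_iff
    by (simp add: linear_diff[OF linear_block] block_diff_op shrink_eq_diff_clip[OF assms(3)])
  have st: "step (u k) (u (Suc k))" for k
    using assms(6) unfolding step_def ftvcs_def w_Suc[symmetric] by blast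
  obtain l where l: "u \<longlonglongrightarrow> l" "reduced_gradient l = 0"
    using converges_to_stationary_point[of u, OF st] by blast
  define wl where "wl = ?D *v l - clip_blocks \<beta> (?D *v l)"
  have "(\<lambda>k. w (Suc k)) \<longlonglongrightarrow> wl"
    unfolding w_Suc wl_def by (intro tendsto_intros tendsto_P tendsto_mat l(1))
  then have "w \<longlonglongrightarrow> wl" by (rule LIMSEQ_imp_Suc)
  moreover have "is_arg_min (\<lambda>(w, u). penalized_objective A f \<mu> \<beta> w u) (\<lambda>_. True) (wl, l)"
    using objective_minimal_if_stationary[OF l(2)]
    by (auto simp: is_arg_min_def objective_eq wl_def not_less)
  ultimately show ?thesis
    using l q_linear[of u, OF st l] by blast
qed

end
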